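(* Let $J=\psi\circ G$ be the exact-penalty function described in the context, let $z^0\in\mathbb{R}^{n_z}$, and suppose the sublevel set $\{z\in\mathbb{R}^{n_z} \mid J(z)\le J(z^0)\}$ is compact. Let $(z^k)_{k\ge 0}$ be an infinite sequence of (accepted) iterates generated by the SCvx algorithm started at $z^0$, and let $\bar z$ be a limit point (i.e. the limit of some subsequence) of $(z^k)$ with $J(\bar z)>-\infty$. Suppose that $\bar z$ is feasible for the constrained problem (P) and that the following hold at $\bar z$: (i) (LICQ) the gradients $\nabla g_i(\bar z)$, $i\in I_{eq}\cup I_{ac}(\bar z)$, together with $\nabla h_j(\bar z)$, $j\in J_{ac}(\bar z)$, are linearly independent; (ii) (strict complementarity) there exist multipliers $\bar\mu_i\in\mathbb{R}$ for $i\in I_{eq}$, $\bar\mu_i>0$ for $i\in I_{ac}(\bar z)$, and $\bar\sigma_j>0$ for $j\in J_{ac}(\bar z)$, such that $$\nabla g_0(\bar z)+\sum_{i\in I_{eq}\cup I_{ac}(\bar z)}\bar\mu_i\nabla g_i(\bar z)+\sum_{j\in J_{ac}(\bar z)}\bar\sigma_j\nabla h_j(\bar z)=0,$$ and the penalty weights satisfy $\lambda_i>|\bar\mu_i|$ for all $i\in I_{eq}\cup I_{ac}(\bar z)$ and $\tau_j>\bar\sigma_j$ for all $j\in J_{ac}(\bar z)$; (iii) (binding) $|I_{ac}(\bar z)|+|J_{ac}(\bar z)|\ge n_u(N-1)$. Then the whole sequence converges to $\bar z$: $\lim_{k\to\infty}z^k=\bar z$.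
   Context: Problem. Let $N\ge 2$, $n_x,n_u\ge 1$ be integers; the variable $z=(x,u)\in\mathbb{R}^{n_z}$, $n_z=n_xN+n_u(N-1)$, collects the states $x_1,\dots,x_N\in\mathbb{R}^{n_x}$ and controls $u_1,\dots,u_{N-1}\in\mathbb{R}^{n_u}$ of a discrete-time optimal control problem. Problem (P) is: minimize $g_0(z)$ subject to $g_i(z)=0$ for $i\in I_{eq}$, $g_i(z)\le 0$ for $i\in I_{ineq}$, $h_j(z)\le 0$ for $j\in J_{ineq}$, where the index sets are finite, $I_{eq}$ and $I_{ineq}$ are disjoint and do not contain $0$, all $g_0,g_i,h_j:\mathbb{R}^{n_z}\to\mathbb{R}$ are $C^1$ and the $h_j$ are convex. The equality constraints encode the dynamics and the initial condition, so $|I_{eq}|=n_xN=n_z-n_u(N-1)$. Active sets: $I_{ac}(z)=\{i\in I_{ineq}\mid g_i(z)=0\}$, $J_{ac}(z)=\{j\in J_{ineq}\mid h_j(z)=0\}$. Penalty function. Fix weights $\lambda_i>0$ ($i\in I_{eq}\cup I_{ineq}$), $\tau_j>0$ ($j\in J_{ineq}$). Put $$J(z)=g_0(z)+\sum_{i\in I_{eq}}\lambda_i|g_i(z)|+\sum_{i\in I_{ineq}}\lambda_i\max(0,g_i(z))+\sum_{j\in J_{ineq}}\tau_j\max(0,h_j(z)).$$ Thus $J(z)=\psi(G(z))$, where $G=(g_0,(g_i)_i,(h_j)_j)$ is $C^1$ and $\psi$ is the convex function $\psi(a,b,c)=a+\sum_{i\in I_{eq}}\lambda_i|b_i|+\sum_{i\in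 I_{ineq}}\lambda_i\max(0,b_i)+\sum_{j\in J_{ineq}}\tau_j\max(0,c_j)$. $\nabla G(z)^\top d$ denotes the derivative of $G$ at $z$ applied to $d$; $\|\cdot\|$ is the Euclidean norm. SCvx algorithm. Fix parameters $0<\rho_0<\rho_1<\rho_2<1$, $r_l>0$, $\alpha>1$, $\beta'>1$, a starting point $z^0$ and an initial radius $r^0>0$. At iteration $k$, given $z^k$ and $r^k$: (1) let $d^k$ be a solution of the trust-region subproblem: minimize $L^k(d)=\psi(G(z^k)+\nabla G(z^k)^\top d)$ subject to $\|d\|\le r^k$. (2) Put $\Delta J^k=J(z^k)-J(z^k+d^k)$ and $\Delta L^k=J(z^k)-L^k(d^k)$; if $\Delta L^k=0$ stop, otherwise let $\rho^k=\Delta J^k/\Delta L^k$. (3) If $\rho^k<\rho_0$, reject the step, replace $r^k$ by $r^k/\alpha$ and return to (1) with the same $z^k$. Otherwise accept: $z^{k+1}=z^k+d^k$; set $\tilde r=r^k/\alpha$ if $\rho^k<\rho_1$, $\tilde r=r^k$ if $\rho_1\le\rho^k<\rho_2$, $\tilde r=\beta' r^k$ if $\rho^k\ge\rho_2$; set $r^{k+1}=\max(\tilde r,r_l)$ and go to iteration $k+1$. The sequence $(z^k)$ consists of the accepted iterates. *)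

theory Defs
  imports "HOL-Analysis.Analysis"
begin

text \<open>Only meaningful where \<open>f\<close> is differentiable.\<close>

definition gradient :: "(real^'n \<Rightarrow> real) \<Rightarrow> real^'n \<Rightarrow> real^'n" where
  "gradient f z = (THE D. GDERIV f z :> D)"

definition C1 :: "(real^'n \<Rightarrow> real) \<Rightarrow> bool" where
  "C1 f \<longleftrightarrow> (\<forall>z. f differentiable (at z)) \<and> continuous_on UNIV (gradient f)"

text \<open>
  Linear independence of the indexed family \<open>(v i)\<close>, \<open>i \<in> S\<close>. The library predicate
  \<^const>\<open>independent\<close> speaks about sets of vectors and does not see a vector that is listed
  twice, hence the injectivity requirement.
\<close>

definition independent_family :: "('i \<Rightarrow> real^'n) \<Rightarrow> 'i set \<Rightarrow> bool" where
  "independent_family v S \<longleftrightarrow> inj_on v S \<and> independent (v ` S)"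

text \<open>
  The functions of the problem are families \<open>g, h :: nat \<Rightarrow> real^'n \<Rightarrow> real\<close>; the objective is
  \<open>g 0\<close>. Their values outside the index sets are irrelevant.
\<close>

definition feasible ::
  "(nat \<Rightarrow> real^'n \<Rightarrow> real) \<Rightarrow> (nat \<Rightarrow> real^'n \<Rightarrow> real) \<Rightarrow> nat set \<Rightarrow> nat set \<Rightarrow> nat set
    \<Rightarrow> real^'n \<Rightarrow> bool" where
  "feasible g h Ieq Iineq Jineq z \<longleftrightarrow>
     (\<forall>i\<in>Ieq. g i z = 0) \<and> (\<forall>i\<in>Iineq. g i z \<le> 0) \<and> (\<forall>j\<in>Jineq. h j z \<le> 0)"

definition active :: "(nat \<Rightarrow> real^'n \<Rightarrow> real) \<Rightarrow> nat set \<Rightarrow> real^'n \<Rightarrow> nat set" where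
  "active f S z = {i \<in> S. f i z = 0}"

text \<open>A point of the codomain of \<open>G\<close> is a triple \<open>(a, b, c)\<close>, with \<open>b\<close> and \<open>c\<close> indexed families.\<close>

type_synonym outer_space = "real \<times> (nat \<Rightarrow> real) \<times> (nat \<Rightarrow> real)"

definition psi ::
  "nat set \<Rightarrow> nat set \<Rightarrow> nat set \<Rightarrow> (nat \<Rightarrow> real) \<Rightarrow> (nat \<Rightarrow> real) \<Rightarrow> outer_space \<Rightarrow> real" where
  "psi Ieq Iineq Jineq lam tau = (\<lambda>(a, b, c).
     a + (\<Sum>i\<in>Ieq. lam i * \<bar>b i\<bar>) + (\<Sum>i\<in>Iineq. lam i * max 0 (b i))
       + (\<Sum>j\<in>Jineq. tau j * max 0 (c j)))"

definition G ::
  "(nat \<Rightarrow> real^'n \<Rightarrow> real) \<Rightarrow> (nat \<Rightarrow> real^'n \<Rightarrow> real) \<Rightarrow> real^'n \<Rightarrow> outer_space" where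
  "G g h z = (g 0 z, (\<lambda>i. g i z), (\<lambda>j. h j z))"

text \<open>The first-order expansion \<open>G(z) + \<nabla>G(z)\<^sup>T d\<close>, taken componentwise.\<close>

definition G_lin ::
  "(nat \<Rightarrow> real^'n \<Rightarrow> real) \<Rightarrow> (nat \<Rightarrow> real^'n \<Rightarrow> real) \<Rightarrow> real^'n \<Rightarrow> real^'n \<Rightarrow> outer_space" where
  "G_lin g h z d =
     (g 0 z + gradient (g 0) z \<bullet> d,
      (\<lambda>i. g i z + gradient (g i) z \<bullet> d),
      (\<lambda>j. h j z + gradient (h j) z \<bullet> d))"

definition trust_region_solution :: "(real^'n \<Rightarrow> real) \<Rightarrow> real \<Rightarrow> real^'n \<Rightarrow> bool" where
  "trust_region_solution L r d \<longleftrightarrow> norm d \<le> r \<and> (\<forall>d'. norm d' \<le> r \<longrightarrow> L d \<le> L d')"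

definition actual_change :: "(real^'n \<Rightarrow> real) \<Rightarrow> real^'n \<Rightarrow> real^'n \<Rightarrow> real" where
  "actual_change J z d = J z - J (z + d)"

definition predicted_change ::
  "(real^'n \<Rightarrow> real) \<Rightarrow> (real^'n \<Rightarrow> real^'n \<Rightarrow> real) \<Rightarrow> real^'n \<Rightarrow> real^'n \<Rightarrow> real" where
  "predicted_change J L z d = J z - L z d"

definition change_ratio ::
  "(real^'n \<Rightarrow> real) \<Rightarrow> (real^'n \<Rightarrow> real^'n \<Rightarrow> real) \<Rightarrow> real^'n \<Rightarrow> real^'n \<Rightarrow> real" where
  "change_ratio J L z d = actual_change J z d / predicted_change J L z d"

definition new_radius :: "real \<Rightarrow> real \<Rightarrow> real \<Rightarrow> real \<Rightarrow> real \<Rightarrow> real \<Rightarrow> real \<Rightarrow> real" where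
  "new_radius \<rho>1 \<rho>2 rl \<alpha> \<beta>' \<rho> r =
     max (if \<rho> < \<rho>1 then r / \<alpha> else if \<rho> < \<rho>2 then r else \<beta>' * r) rl"

text \<open>
  One full iteration, from \<open>(z\<^sup>k, r\<^sup>k)\<close> to \<open>(z\<^sup>k\<^sup>+\<^sup>1, r\<^sup>k\<^sup>+\<^sup>1)\<close>: a finite (possibly empty) run of
  rejected trials, each of which shrinks the radius and keeps the iterate, followed by an
  accepted trial. If a trial has predicted change zero the algorithm stops, so that neither
  rule applies to it. Any solution of the subproblem may be chosen in a trial.
\<close>

inductive scvx_step ::
  "(real^'n \<Rightarrow> real) \<Rightarrow> (real^'n \<Rightarrow> real^'n \<Rightarrow> real)
    \<Rightarrow> real \<Rightarrow> real \<Rightarrow> real \<Rightarrow> real \<Rightarrow> real \<Rightarrow> real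
    \<Rightarrow> real^'n \<Rightarrow> real \<Rightarrow> real^'n \<Rightarrow> real \<Rightarrow> bool"
  for J L \<rho>0 \<rho>1 \<rho>2 rl \<alpha> \<beta>' where
  reject:
    "\<lbrakk>trust_region_solution (L z) r d; predicted_change J L z d \<noteq> 0;
      change_ratio J L z d < \<rho>0;
      scvx_step J L \<rho>0 \<rho>1 \<rho>2 rl \<alpha> \<beta>' z (r / \<alpha>) z' r'\<rbrakk>
     \<Longrightarrow> scvx_step J L \<rho>0 \<rho>1 \<rho>2 rl \<alpha> \<beta>' z r z' r'"
| accept:
    "\<lbrakk>trust_region_solution (L z) r d; predicted_change J L z d \<noteq> 0;
      change_ratio J L z d \<ge> \<rho>0\<rbrakk>
     \<Longrightarrow> scvx_step J L \<rho>0 \<rho>1 \<rho>2 rl \<alpha> \<beta>' z r (z + d)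
          (new_radius \<rho>1 \<rho>2 rl \<alpha> \<beta>' (change_ratio J L z d) r)"

definition scvx_iterates ::
  "(real^'n \<Rightarrow> real) \<Rightarrow> (real^'n \<Rightarrow> real^'n \<Rightarrow> real)
    \<Rightarrow> real \<Rightarrow> real \<Rightarrow> real \<Rightarrow> real \<Rightarrow> real \<Rightarrow> real
    \<Rightarrow> real^'n \<Rightarrow> real \<Rightarrow> (nat \<Rightarrow> real^'n) \<Rightarrow> bool" where
  "scvx_iterates J L \<rho>0 \<rho>1 \<rho>2 rl \<alpha> \<beta>' z0 r0 z \<longleftrightarrow>
     (\<exists>r. z 0 = z0 \<and> r 0 = r0 \<and>
        (\<forall>k. scvx_step J L \<rho>0 \<rho>1 \<rho>2 rl \<alpha> \<beta>' (z k) (r k) (z (Suc k)) (r (Suc k))))"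

definition penalty ::
  "(nat \<Rightarrow> real^'n \<Rightarrow> real) \<Rightarrow> (nat \<Rightarrow> real^'n \<Rightarrow> real) \<Rightarrow> nat set \<Rightarrow> nat set \<Rightarrow> nat set
    \<Rightarrow> (nat \<Rightarrow> real) \<Rightarrow> (nat \<Rightarrow> real) \<Rightarrow> real^'n \<Rightarrow> real" where
  "penalty g h Ieq Iineq Jineq lam tau z = psi Ieq Iineq Jineq lam tau (G g h z)"

definition lin_penalty ::
  "(nat \<Rightarrow> real^'n \<Rightarrow> real) \<Rightarrow> (nat \<Rightarrow> real^'n \<Rightarrow> real) \<Rightarrow> nat set \<Rightarrow> nat set \<Rightarrow> nat set
    \<Rightarrow> (nat \<Rightarrow> real) \<Rightarrow> (nat \<Rightarrow> real) \<Rightarrow> real^'n \<Rightarrow> real^'n \<Rightarrow> real" where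
  "lin_penalty g h Ieq Iineq Jineq lam tau z d = psi Ieq Iineq Jineq lam tau (G_lin g h z d)"

end

theory Submission
  imports Defs
begin

text \<open>
  Write \<open>J\<close> for the penalty function, \<open>L z d\<close> for its model obtained by linearizing \<open>G\<close>
  at \<open>z\<close>, and \<open>x\<close> for the limit point. The idea is that \<open>x\<close> is a sharp minimum, from which
  a descent method can escape only by a long step, and that long steps are impossible near a
  sharp minimum.

  Counting shows that the active gradients at \<open>x\<close> form a basis: there are \<open>n\<^sub>x N\<close> equality
  constraints and at least \<open>n\<^sub>u (N - 1)\<close> active inequality constraints, and they are linearly
  independent. Substituting the stationarity equation for the gradient of the objective, each
  active constraint with gradient \<open>v\<close> contributes to \<open>L x d - J x\<close> at least a positive multiple
  of \<open>\<bar>v \<bullet> d\<bar>\<close>, because its multiplier lies strictly inside the subdifferential of the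
  penalty term. As the vectors \<open>v\<close> span the space, \<open>L x d \<ge> J x + c * norm d\<close> for some \<open>c > 0\<close>
  and all \<open>d\<close> (\<open>lin_penalty_sharp_minimum\<close>).

  Two consequences follow from the smoothness of \<open>G\<close> and the Lipschitz continuity of \<open>\<psi>\<close>.
  By first-order expansion (\<open>penalty_first_order_expansion\<close>), \<open>J y \<ge> J x + c/2 * norm (y - x)\<close>
  for \<open>y\<close> near \<open>x\<close>. And since \<open>L y\<close> is close to \<open>L x\<close> up to an error of the form
  \<open>e * (1 + norm d)\<close> (\<open>lin_penalty_perturbation\<close>), the growth of the model survives for base
  points \<open>y\<close> near \<open>x\<close>: any step \<open>d\<close> with \<open>L y d \<le> J y\<close> has to be short, whatever the trust
  region radius is.

  The algorithm never increases \<open>J\<close> (\<open>scvx_step_descent\<close>). Once an iterate is close to \<open>x\<close> with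
  \<open>J\<close> close to \<open>J x\<close>, the next one is still in the region where \<open>J\<close> grows linearly, and its value
  then forces it back into the same small ball
  (\<open>descent_converges_to_sharp_cluster_point\<close>).
\<close>

section \<open>First-order estimates for continuously differentiable functions\<close>

lemma GDERIV_gradient:
  fixes f :: "real^'n \<Rightarrow> real"
  assumes "f differentiable (at z)"
  shows "GDERIV f z :> gradient f z"
proof -
  obtain D where D: "(f has_derivative D) (at z)"
    using assms by (auto simp: differentiable_def)
  then have "linear D"
    by (rule has_derivative_linear)
  then have "D = (\<lambda>d. d \<bullet> adjoint D 1)"
    by (auto simp: adjoint_works)
  then have ex: "GDERIV f z :> adjoint D 1"
    using D by (simp add: gderiv_def)
  have unique: "D2 = D1" if "GDERIV f z :> D1" "GDERIV f z :> D2" for D1 D2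
  proof -
    have "(\<lambda>d. d \<bullet> D1) = (\<lambda>d. d \<bullet> D2)"
      using that by (auto simp: gderiv_def intro: has_derivative_unique)
    then show ?thesis
      by (metis vector_eq_ldot)
  qed
  show ?thesis
    unfolding gradient_def by (rule theI[where P = "\<lambda>D. GDERIV f z :> D"]) (use ex unique in blast)+
qed

lemma C1_first_order_expansion:
  assumes "C1 f" "e > 0"
  shows "\<forall>\<^sub>F y in nhds z. \<bar>f y - (f z + gradient f z \<bullet> (y - z))\<bar> \<le> e * norm (y - z)"
proof -
  have "(f has_derivative (\<lambda>d. d \<bullet> gradient f z)) (at z)"
    using GDERIV_gradient assms(1) by (auto simp: C1_def gderiv_def)
  then obtain \<delta> where "\<delta> > 0"
    and \<delta>: "\<And>y. norm (y - z) < \<delta> \<Longrightarrow>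
          norm (f y - f z - (y - z) \<bullet> gradient f z) \<le> e * norm (y - z)"
    using \<open>e > 0\<close> unfolding has_derivative_at_alt by blast
  show ?thesis
    unfolding eventually_nhds_metric
    using \<open>\<delta> > 0\<close> \<delta> by (auto simp: dist_norm inner_commute algebra_simps intro!: exI[of _ \<delta>])
qed

text \<open>
  The estimate is uniform in \<open>d\<close>, unlike mere pointwise convergence of the linearizations; this
  is what later bounds steps without an a priori bound on their length.
\<close>

lemma C1_linearization_perturbation:
  assumes "C1 f" "e > 0"
  shows "\<forall>\<^sub>F y in nhds z. \<forall>d.
    \<bar>(f y + gradient f y \<bullet> d) - (f z + gradient f z \<bullet> d)\<bar> \<le> e * (1 + norm d)"
proof -
  have "isCont f z"
    using assms(1) by (auto simp: C1_def intro: differentiable_imp_continuous_within)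
  then have "(f \<longlongrightarrow> f z) (nhds z)"
    by (simp add: continuous_at tendsto_at_iff_tendsto_nhds)
  then have f: "\<forall>\<^sub>F y in nhds z. dist (f y) (f z) < e"
    using \<open>e > 0\<close> by (rule tendstoD)
  have "isCont (gradient f) z"
    using assms(1) by (simp add: C1_def continuous_on_eq_continuous_at)
  then have "(gradient f \<longlongrightarrow> gradient f z) (nhds z)"
    by (simp add: continuous_at tendsto_at_iff_tendsto_nhds)
  then have "\<forall>\<^sub>F y in nhds z. dist (gradient f y) (gradient f z) < e"
    using \<open>e > 0\<close> by (rule tendstoD)
  with f show ?thesis
  proof eventually_elim
    case (elim y)
    show ?case
    proof
      fix d
      have "\<bar>(gradient f y - gradient f z) \<bullet> d\<bar> \<le> norm (gradient f y - gradient f z) * norm d"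
        by (rule Cauchy_Schwarz_ineq2)
      also have "\<dots> \<le> e * norm d"
        using elim by (intro mult_right_mono) (auto simp: dist_norm)
      finally show "\<bar>(f y + gradient f y \<bullet> d) - (f z + gradient f z \<bullet> d)\<bar> \<le> e * (1 + norm d)"
        using elim(1) by (simp add: dist_real_def algebra_simps inner_diff_left)
    qed
  qed
qed

section \<open>The penalty function and its linearized model\<close>

text \<open>A Lipschitz constant of \<open>\<psi>\<close> with respect to the maximum norm on its arguments.\<close>

definition psi_lipschitz_const ::
  "nat set \<Rightarrow> nat set \<Rightarrow> nat set \<Rightarrow> (nat \<Rightarrow> real) \<Rightarrow> (nat \<Rightarrow> real) \<Rightarrow> real" where
  "psi_lipschitz_const Ieq Iineq Jineq lam tau = 1 + sum lam Ieq + sum lam Iineq + sum tau Jineq"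

lemma psi_lipschitz:
  assumes lam: "\<And>i. i \<in> Ieq \<union> Iineq \<Longrightarrow> lam i > 0" and tau: "\<And>j. j \<in> Jineq \<Longrightarrow> tau j > 0"
    and a: "\<bar>a - a'\<bar> \<le> t" and b: "\<And>i. i \<in> Ieq \<union> Iineq \<Longrightarrow> \<bar>b i - b' i\<bar> \<le> t"
    and c: "\<And>j. j \<in> Jineq \<Longrightarrow> \<bar>c j - c' j\<bar> \<le> t"
  shows "\<bar>psi Ieq Iineq Jineq lam tau (a, b, c) - psi Ieq Iineq Jineq lam tau (a', b', c')\<bar>
    \<le> psi_lipschitz_const Ieq Iineq Jineq lam tau * t"
proof -
  have weighted: "\<bar>(\<Sum>i\<in>S. w i * \<phi> (p i)) - (\<Sum>i\<in>S. w i * \<phi> (q i))\<bar> \<le> sum w S * t"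
    if "\<And>i. i \<in> S \<Longrightarrow> w i > 0" "\<And>i. i \<in> S \<Longrightarrow> \<bar>p i - q i\<bar> \<le> t"
      "\<And>x y. \<bar>\<phi> x - \<phi> y\<bar> \<le> \<bar>x - y\<bar>"
    for S :: "nat set" and w p q :: "nat \<Rightarrow> real" and \<phi> :: "real \<Rightarrow> real"
  proof -
    have "\<bar>(\<Sum>i\<in>S. w i * \<phi> (p i)) - (\<Sum>i\<in>S. w i * \<phi> (q i))\<bar> = \<bar>\<Sum>i\<in>S. w i * (\<phi> (p i) - \<phi> (q i))\<bar>"
      by (simp add: sum_subtractf right_diff_distrib)
    also have "\<dots> \<le> (\<Sum>i\<in>S. \<bar>w i * (\<phi> (p i) - \<phi> (q i))\<bar>)"
      by (rule sum_abs)
    also have "\<dots> \<le> (\<Sum>i\<in>S. w i * t)"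
    proof (rule sum_mono)
      fix i assume "i \<in> S"
      then have "w i * \<bar>\<phi> (p i) - \<phi> (q i)\<bar> \<le> w i * t"
        using that(1)[OF \<open>i \<in> S\<close>] that(2)[OF \<open>i \<in> S\<close>] that(3)[of "p i" "q i"]
        by (intro mult_left_mono) auto
      then show "\<bar>w i * (\<phi> (p i) - \<phi> (q i))\<bar> \<le> w i * t"
        using that(1)[OF \<open>i \<in> S\<close>] by (simp add: abs_mult)
    qed
    finally show ?thesis
      by (simp add: sum_distrib_right)
  qed
  have eq: "\<bar>(\<Sum>i\<in>Ieq. lam i * \<bar>b i\<bar>) - (\<Sum>i\<in>Ieq. lam i * \<bar>b' i\<bar>)\<bar> \<le> sum lam Ieq * t"
    using lam b by (intro weighted) auto
  have ineq: "\<bar>(\<Sum>i\<in>Iineq. lam i * max 0 (b i)) - (\<Sum>i\<in>Iineq. lam i * max 0 (b' i))\<bar>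
      \<le> sum lam Iineq * t"
    using lam b by (intro weighted) auto
  have jneq: "\<bar>(\<Sum>j\<in>Jineq. tau j * max 0 (c j)) - (\<Sum>j\<in>Jineq. tau j * max 0 (c' j))\<bar>
      \<le> sum tau Jineq * t"
    using tau c by (intro weighted) auto
  show ?thesis
    using a eq ineq jneq
    unfolding psi_def psi_lipschitz_const_def distrib_right prod.case by linarith
qed

lemma psi_lipschitz_const_pos:
  assumes "\<And>i. i \<in> Ieq \<union> Iineq \<Longrightarrow> lam i > 0" and "\<And>j. j \<in> Jineq \<Longrightarrow> tau j > 0"
  shows "psi_lipschitz_const Ieq Iineq Jineq lam tau > 0"
proof -
  have "sum lam Ieq \<ge> 0" "sum lam Iineq \<ge> 0" "sum tau Jineq \<ge> 0"
    using assms by (auto intro!: sum_nonneg simp: less_imp_le)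
  then show ?thesis
    by (simp add: psi_lipschitz_const_def)
qed

lemma lin_penalty_zero:
  "lin_penalty g h Ieq Iineq Jineq lam tau z 0 = penalty g h Ieq Iineq Jineq lam tau z"
  by (simp add: lin_penalty_def penalty_def G_lin_def G_def)

text \<open>
  Both estimates are componentwise estimates for \<open>G\<close> pushed through the Lipschitz function \<open>\<psi>\<close>;
  only finitely many components matter, so the neighbourhoods can be intersected.
\<close>

lemma
  assumes fin: "finite Ieq" "finite Iineq" "finite Jineq"
    and g: "\<And>i. i \<in> {0} \<union> Ieq \<union> Iineq \<Longrightarrow> C1 (g i)" and h: "\<And>j. j \<in> Jineq \<Longrightarrow> C1 (h j)"
    and lam: "\<And>i. i \<in> Ieq \<union> Iineq \<Longrightarrow> lam i > 0" and tau: "\<And>j. j \<in> Jineq \<Longrightarrow> tau j > 0"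
    and "e > 0"
  shows penalty_first_order_expansion:
    "\<forall>\<^sub>F y in nhds z. \<bar>penalty g h Ieq Iineq Jineq lam tau y
        - lin_penalty g h Ieq Iineq Jineq lam tau z (y - z)\<bar> \<le> e * norm (y - z)"
    and lin_penalty_perturbation:
    "\<forall>\<^sub>F y in nhds z. \<forall>d. \<bar>lin_penalty g h Ieq Iineq Jineq lam tau y d
        - lin_penalty g h Ieq Iineq Jineq lam tau z d\<bar> \<le> e * (1 + norm d)"
proof -
  define M where "M = psi_lipschitz_const Ieq Iineq Jineq lam tau"
  have M: "M > 0"
    unfolding M_def using lam tau by (rule psi_lipschitz_const_pos)
  have eM: "e / M > 0" "M * (e / M * t) = e * t" for t
    using M \<open>e > 0\<close> by auto
  note exp = C1_first_order_expansion[OF _ eM(1)]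
  have "\<forall>\<^sub>F y in nhds z. \<forall>i\<in>{0} \<union> Ieq \<union> Iineq.
      \<bar>g i y - (g i z + gradient (g i) z \<bullet> (y - z))\<bar> \<le> e / M * norm (y - z)"
    using g fin by (intro eventually_ball_finite ballI exp) auto
  moreover have "\<forall>\<^sub>F y in nhds z. \<forall>j\<in>Jineq.
      \<bar>h j y - (h j z + gradient (h j) z \<bullet> (y - z))\<bar> \<le> e / M * norm (y - z)"
    using h fin by (intro eventually_ball_finite ballI exp) auto
  ultimately show "\<forall>\<^sub>F y in nhds z. \<bar>penalty g h Ieq Iineq Jineq lam tau y
        - lin_penalty g h Ieq Iineq Jineq lam tau z (y - z)\<bar> \<le> e * norm (y - z)"
  proof eventually_elim
    case (elim y)
    then show ?case
      unfolding penalty_def lin_penalty_def G_def G_lin_def eM(2)[symmetric] M_def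
      by (intro psi_lipschitz lam tau) auto
  qed
  note pert = C1_linearization_perturbation[OF _ eM(1)]
  have "\<forall>\<^sub>F y in nhds z. \<forall>i\<in>{0} \<union> Ieq \<union> Iineq. \<forall>d.
      \<bar>(g i y + gradient (g i) y \<bullet> d) - (g i z + gradient (g i) z \<bullet> d)\<bar> \<le> e / M * (1 + norm d)"
    using g fin by (intro eventually_ball_finite ballI pert) auto
  moreover have "\<forall>\<^sub>F y in nhds z. \<forall>j\<in>Jineq. \<forall>d.
      \<bar>(h j y + gradient (h j) y \<bullet> d) - (h j z + gradient (h j) z \<bullet> d)\<bar> \<le> e / M * (1 + norm d)"
    using h fin by (intro eventually_ball_finite ballI pert) auto
  ultimately show "\<forall>\<^sub>F y in nhds z. \<forall>d. \<bar>lin_penalty g h Ieq Iineq Jineq lam tau y d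
        - lin_penalty g h Ieq Iineq Jineq lam tau z d\<bar> \<le> e * (1 + norm d)"
  proof eventually_elim
    case (elim y)
    show ?case
    proof
      fix d
      show "\<bar>lin_penalty g h Ieq Iineq Jineq lam tau y d
        - lin_penalty g h Ieq Iineq Jineq lam tau z d\<bar> \<le> e * (1 + norm d)"
        unfolding lin_penalty_def G_lin_def eM(2)[symmetric] M_def
        using elim unfolding M_def by (intro psi_lipschitz lam tau) auto
    qed
  qed
qed

section \<open>Sharpness at a nondegenerate vertex\<close>

text \<open>
  The left-hand side is a norm in \<open>d\<close>: an independent family with at least as many members as the
  dimension spans the space, so no nonzero \<open>d\<close> is orthogonal to all of it. The constant is the
  minimum over the unit sphere.
\<close>

lemma weighted_abs_inner_sum_ge_norm:
  fixes v :: "'i \<Rightarrow> real^'n"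
  assumes indep: "independent_family v S" and card: "card S \<ge> CARD('n)"
    and fin: "finite S" and w: "\<And>s. s \<in> S \<Longrightarrow> w s > 0"
  shows "\<exists>c>0. \<forall>d. (\<Sum>s\<in>S. w s * \<bar>v s \<bullet> d\<bar>) \<ge> c * norm d"
proof -
  define F where "F d = (\<Sum>s\<in>S. w s * \<bar>v s \<bullet> d\<bar>)" for d
  have "card (v ` S) = card S"
    using indep by (simp add: independent_family_def card_image)
  then have "UNIV \<subseteq> span (v ` S)"
    using indep card
    by (intro card_ge_dim_independent) (auto simp: independent_family_def)
  have pos: "F d > 0" if "d \<noteq> 0" for d
  proof (rule ccontr)
    assume "\<not> F d > 0"
    moreover have "F d \<ge> 0"
      unfolding F_def using w by (intro sum_nonneg) (simp add: less_imp_le)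
    ultimately have "F d = 0" by simp
    then have "\<forall>s\<in>S. w s * \<bar>v s \<bullet> d\<bar> = 0"
      unfolding F_def using fin w by (subst (asm) sum_nonneg_eq_0_iff) (auto simp: less_imp_le)
    then have "orthogonal d x" if "x \<in> v ` S" for x
      using w that by (fastforce simp: orthogonal_def inner_commute)
    moreover have "d \<in> span (v ` S)"
      using \<open>UNIV \<subseteq> span (v ` S)\<close> by (rule subsetD) simp
    ultimately have "orthogonal d d"
      by (rule orthogonal_to_span[rotated])
    with \<open>d \<noteq> 0\<close> show False
      by (simp add: orthogonal_def)
  qed
  have "continuous_on (sphere 0 1) F"
    unfolding F_def by (intro continuous_intros)
  then obtain x :: "real^'n" where x: "x \<in> sphere 0 1" "\<And>y. y \<in> sphere 0 1 \<Longrightarrow> F x \<le> F y"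
    using continuous_attains_inf[of "sphere 0 1" F] by auto
  show ?thesis
  proof (intro exI conjI allI)
    show "F x > 0" using x(1) by (intro pos) auto
    fix d
    show "(\<Sum>s\<in>S. w s * \<bar>v s \<bullet> d\<bar>) \<ge> F x * norm d"
    proof (cases "d = 0")
      case False
      have "F d = F (norm d *\<^sub>R sgn d)"
        using False by (simp add: sgn_div_norm)
      also have "\<dots> = norm d * F (sgn d)"
        by (simp add: F_def abs_mult sum_distrib_left mult_ac)
      also have "\<dots> \<ge> norm d * F x"
        using False by (intro mult_left_mono x) (auto simp: norm_sgn)
      finally show ?thesis
        by (simp add: F_def mult.commute)
    qed simp
  qed
qed

text \<open>
  Eliminating the gradient of the objective by stationarity turns the growth of the model into a
  sum of terms \<open>lam * \<bar>t\<bar> - \<mu> * t\<close> and \<open>lam * max 0 t - \<mu> * t\<close>, with \<open>t\<close> the derivative of an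
  active constraint along \<open>d\<close>. Such a term grows at least linearly in \<open>\<bar>t\<bar>\<close> precisely because
  \<open>\<bar>\<mu>\<bar> < lam\<close> and \<open>0 < \<mu> < lam\<close>, respectively; strict complementarity supplies \<open>0 < \<mu>\<close>, which
  makes the model grow also when an inequality constraint becomes inactive. The penalty terms of
  inactive constraints are nonnegative and vanish for \<open>d = 0\<close>, so dropping them keeps the
  inequality.
\<close>

lemma lin_penalty_sharp_minimum:
  fixes g h :: "nat \<Rightarrow> real^'n \<Rightarrow> real"
  assumes fin: "finite Ieq" "finite Iineq" "finite Jineq" and disj: "Ieq \<inter> Iineq = {}"
    and lam: "\<And>i. i \<in> Ieq \<union> Iineq \<Longrightarrow> lam i > 0" and tau: "\<And>j. j \<in> Jineq \<Longrightarrow> tau j > 0"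
    and feas: "feasible g h Ieq Iineq Jineq z"
    and licq: "independent_family (case_sum (\<lambda>i. gradient (g i) z) (\<lambda>j. gradient (h j) z))
         ((Ieq \<union> active g Iineq z) <+> active h Jineq z)"
    and card: "card Ieq + card (active g Iineq z) + card (active h Jineq z) \<ge> CARD('n)"
    and mu: "\<And>i. i \<in> active g Iineq z \<Longrightarrow> \<mu> i > 0"
    and sigma: "\<And>j. j \<in> active h Jineq z \<Longrightarrow> \<sigma> j > 0"
    and stationary: "gradient (g 0) z
           + (\<Sum>i\<in>Ieq \<union> active g Iineq z. \<mu> i *\<^sub>R gradient (g i) z)
           + (\<Sum>j\<in>active h Jineq z. \<sigma> j *\<^sub>R gradient (h j) z) = 0"
    and lam_mu: "\<And>i. i \<in> Ieq \<union> active g Iineq z \<Longrightarrow> lam i > \<bar>\<mu> i\<bar>"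
    and tau_sigma: "\<And>j. j \<in> active h Jineq z \<Longrightarrow> tau j > \<sigma> j"
  shows "\<exists>c>0. \<forall>d. lin_penalty g h Ieq Iineq Jineq lam tau z d
      \<ge> penalty g h Ieq Iineq Jineq lam tau z + c * norm d"
proof -
  define A where "A = active g Iineq z"
  define B where "B = active h Jineq z"
  have sub: "A \<subseteq> Iineq" "B \<subseteq> Jineq" and finAB: "finite A" "finite B"
    using fin by (auto simp: A_def B_def active_def)
  have disjA: "Ieq \<inter> A = {}"
    using disj sub by auto
  \<comment> \<open>The guaranteed growth rate of each constraint's term in the absolute value of its derivative.\<close>
  define wi where "wi i = (if i \<in> Ieq then lam i - \<bar>\<mu> i\<bar> else min (lam i - \<mu> i) (\<mu> i))" for i
  define wj where "wj j = min (tau j - \<sigma> j) (\<sigma> j)" for j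
  let ?v = "case_sum (\<lambda>i. gradient (g i) z) (\<lambda>j. gradient (h j) z)"
  let ?S = "(Ieq \<union> A) <+> B"
  have "card ?S = card Ieq + card A + card B"
    using fin finAB disjA by (simp add: card_Plus card_Un_disjoint)
  then have cardS: "card ?S \<ge> CARD('n)"
    using card by (simp add: A_def B_def)
  have w: "case_sum wi wj s > 0" if "s \<in> ?S" for s
    using that mu sigma lam_mu tau_sigma by (fastforce simp: wi_def wj_def A_def B_def)
  have indep: "independent_family ?v ?S"
    using licq by (simp only: A_def B_def)
  have finS: "finite ?S"
    using fin finAB by simp
  obtain c where "c > 0"
    and c: "\<And>d. (\<Sum>s\<in>?S. case_sum wi wj s * \<bar>?v s \<bullet> d\<bar>) \<ge> c * norm d"
    using weighted_abs_inner_sum_ge_norm[OF indep cardS finS, of "case_sum wi wj", OF w] by blast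
  show ?thesis
  proof (intro exI conjI allI)
    fix d
    define p where "p i = gradient (g i) z \<bullet> d" for i
    define q where "q j = gradient (h j) z \<bullet> d" for j
    have "(gradient (g 0) z
           + (\<Sum>i\<in>Ieq \<union> A. \<mu> i *\<^sub>R gradient (g i) z) + (\<Sum>j\<in>B. \<sigma> j *\<^sub>R gradient (h j) z)) \<bullet> d = 0"
      using stationary by (simp add: A_def B_def)
    then have p0: "p 0 = - (\<Sum>i\<in>Ieq. \<mu> i * p i) - (\<Sum>i\<in>A. \<mu> i * p i) - (\<Sum>j\<in>B. \<sigma> j * q j)"
      using fin finAB disjA
      by (simp add: inner_add_left inner_sum_left p_def q_def sum.union_disjoint)
    have ge: "lin_penalty g h Ieq Iineq Jineq lam tau z d \<ge> g 0 z + p 0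
      + (\<Sum>i\<in>Ieq. lam i * \<bar>p i\<bar>) + (\<Sum>i\<in>A. lam i * max 0 (p i)) + (\<Sum>j\<in>B. tau j * max 0 (q j))"
    proof -
      have "(\<Sum>i\<in>Ieq. lam i * \<bar>g i z + p i\<bar>) = (\<Sum>i\<in>Ieq. lam i * \<bar>p i\<bar>)"
        using feas by (simp add: feasible_def)
      moreover have "(\<Sum>i\<in>A. lam i * max 0 (p i)) \<le> (\<Sum>i\<in>Iineq. lam i * max 0 (g i z + p i))"
      proof -
        have "(\<Sum>i\<in>A. lam i * max 0 (p i)) = (\<Sum>i\<in>A. lam i * max 0 (g i z + p i))"
          by (simp add: A_def active_def)
        also have "\<dots> \<le> (\<Sum>i\<in>Iineq. lam i * max 0 (g i z + p i))"
          using fin sub lam by (intro sum_mono2) (auto simp: less_imp_le)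
        finally show ?thesis .
      qed
      moreover have "(\<Sum>j\<in>B. tau j * max 0 (q j)) \<le> (\<Sum>j\<in>Jineq. tau j * max 0 (h j z + q j))"
      proof -
        have "(\<Sum>j\<in>B. tau j * max 0 (q j)) = (\<Sum>j\<in>B. tau j * max 0 (h j z + q j))"
          by (simp add: B_def active_def)
        also have "\<dots> \<le> (\<Sum>j\<in>Jineq. tau j * max 0 (h j z + q j))"
          using fin sub tau by (intro sum_mono2) (auto simp: less_imp_le)
        finally show ?thesis .
      qed
      ultimately show ?thesis
        by (simp add: lin_penalty_def psi_def G_lin_def p_def q_def)
    qed
    have slack: "min (l - m) m * \<bar>t\<bar> \<le> l * max 0 t - m * t" if "m > 0" for l m t :: real
    proof (cases "t \<ge> 0")
      case True
      then have "min (l - m) m * t \<le> (l - m) * t" by (intro mult_right_mono) auto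
      with True show ?thesis by (simp add: algebra_simps)
    next
      case False
      then have "min (l - m) m * (- t) \<le> m * (- t)" by (intro mult_right_mono) auto
      with False show ?thesis by simp
    qed
    have "(\<Sum>i\<in>Ieq. wi i * \<bar>p i\<bar>) \<le> (\<Sum>i\<in>Ieq. lam i * \<bar>p i\<bar> - \<mu> i * p i)"
    proof (rule sum_mono)
      fix i assume "i \<in> Ieq"
      have "\<mu> i * p i \<le> \<bar>\<mu> i\<bar> * \<bar>p i\<bar>"
        by (metis abs_ge_self abs_mult)
      with \<open>i \<in> Ieq\<close> show "wi i * \<bar>p i\<bar> \<le> lam i * \<bar>p i\<bar> - \<mu> i * p i"
        by (simp add: wi_def algebra_simps)
    qed
    moreover have "(\<Sum>i\<in>A. wi i * \<bar>p i\<bar>) \<le> (\<Sum>i\<in>A. lam i * max 0 (p i) - \<mu> i * p i)"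
    proof (rule sum_mono)
      fix i assume "i \<in> A"
      moreover from this have "i \<notin> Ieq" using disjA by auto
      ultimately show "wi i * \<bar>p i\<bar> \<le> lam i * max 0 (p i) - \<mu> i * p i"
        using slack[of "\<mu> i" "lam i" "p i"] mu by (simp add: wi_def A_def)
    qed
    moreover have "(\<Sum>j\<in>B. wj j * \<bar>q j\<bar>) \<le> (\<Sum>j\<in>B. tau j * max 0 (q j) - \<sigma> j * q j)"
      using slack sigma by (intro sum_mono) (simp add: wj_def B_def)
    moreover have "(\<Sum>s\<in>?S. case_sum wi wj s * \<bar>?v s \<bullet> d\<bar>)
      = (\<Sum>i\<in>Ieq. wi i * \<bar>p i\<bar>) + (\<Sum>i\<in>A. wi i * \<bar>p i\<bar>) + (\<Sum>j\<in>B. wj j * \<bar>q j\<bar>)"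
      using fin finAB disjA by (simp add: sum.Plus sum.union_disjoint p_def q_def)
    moreover have "penalty g h Ieq Iineq Jineq lam tau z = g 0 z"
      using feas by (simp add: penalty_def psi_def G_def feasible_def max_absorb1)
    ultimately show "lin_penalty g h Ieq Iineq Jineq lam tau z d
        \<ge> penalty g h Ieq Iineq Jineq lam tau z + c * norm d"
      using ge p0 c[of d] by (simp add: sum_subtractf)
  qed fact
qed

section \<open>Descent methods near a sharp minimum\<close>

text \<open>
  The zero step is admissible in every subproblem, so a trial step never has a larger model value;
  acceptance then transfers the predicted decrease to \<open>J\<close>.
\<close>

lemma scvx_step_descent:
  assumes "scvx_step J L \<rho>0 \<rho>1 \<rho>2 rl \<alpha> \<beta>' z r z' r'" and "\<rho>0 > 0" and "L z 0 = J z"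
  shows "J z' \<le> J z" and "L z (z' - z) \<le> J z"
proof -
  have "J z' \<le> J z \<and> L z (z' - z) \<le> J z"
    using assms
  proof (induction rule: scvx_step.induct)
    case (accept z r d)
    have "0 \<le> r"
      using accept(1) by (auto simp: trust_region_solution_def intro: order_trans[OF norm_ge_zero])
    then have "L z d \<le> J z"
      using accept by (auto simp: trust_region_solution_def dest: spec[of _ 0])
    moreover have "J z - J (z + d) \<ge> 0"
    proof (rule ccontr)
      assume "\<not> ?thesis"
      then have "change_ratio J L z d \<le> 0"
        using \<open>L z d \<le> J z\<close>
        by (auto simp: change_ratio_def actual_change_def predicted_change_def
            intro: divide_nonpos_nonneg)
      with accept show False by simp
    qed
    ultimately show ?case by simp
  qed auto
  then show "J z' \<le> J z" and "L z (z' - z) \<le> J z" by auto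
qed

text \<open>
  Descent alone does not keep the sequence near \<open>x\<close>, since it may jump to another region with low
  values of \<open>J\<close>; the assumption on the steps excludes this. Within the ball where \<open>J\<close> is sharp, a
  value below \<open>J x + c * \<eta>\<close> means a distance below \<open>\<eta>\<close>, so the ball of radius \<open>\<eta>\<close> is never left
  once it contains an iterate with such a value.
\<close>

lemma descent_converges_to_sharp_cluster_point:
  fixes z :: "nat \<Rightarrow> 'a::metric_space" and J :: "'a \<Rightarrow> real"
  assumes descent: "\<And>k. J (z (Suc k)) \<le> J (z k)"
    and cont: "(J \<longlongrightarrow> J x) (nhds x)"
    and sharp: "c > 0" "\<forall>\<^sub>F y in nhds x. J y \<ge> J x + c * dist y x"
    and steps: "\<And>e. e > 0 \<Longrightarrow> \<forall>\<^sub>F y in nhds x. \<forall>k. z k = y \<longrightarrow> dist (z (Suc k)) y < e"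
    and cluster: "x \<in> closure (range z)"
  shows "z \<longlonglongrightarrow> x"
proof (rule metric_LIMSEQ_I)
  fix \<epsilon> :: real
  assume "\<epsilon> > 0"
  obtain e where "e > 0" and e: "\<And>y. dist y x < e \<Longrightarrow> J y \<ge> J x + c * dist y x"
    using sharp(2) by (auto simp: eventually_nhds_metric)
  obtain \<delta> where "\<delta> > 0" and \<delta>: "\<And>k. dist (z k) x < \<delta> \<Longrightarrow> dist (z (Suc k)) (z k) < e / 2"
    using steps[of "e / 2"] \<open>e > 0\<close> by (auto simp: eventually_nhds_metric)
  define \<eta> where "\<eta> = Min {\<delta>, e / 2, \<epsilon>}"
  have \<eta>: "\<eta> > 0" "\<eta> \<le> \<delta>" "\<eta> \<le> e / 2" "\<eta> \<le> \<epsilon>"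
    using \<open>e > 0\<close> \<open>\<delta> > 0\<close> \<open>\<epsilon> > 0\<close> by (auto simp: \<eta>_def)
  have "\<forall>\<^sub>F y in nhds x. J y < J x + c * \<eta>"
    using cont \<eta>(1) \<open>c > 0\<close> by (intro order_tendstoD) auto
  then obtain \<gamma> where "\<gamma> > 0" and \<gamma>: "\<And>y. dist y x < \<gamma> \<Longrightarrow> J y < J x + c * \<eta>"
    by (auto simp: eventually_nhds_metric)
  obtain K where K: "dist (z K) x < min \<eta> \<gamma>"
    using cluster \<eta>(1) \<open>\<gamma> > 0\<close> unfolding closure_approachable
    by (metis min_less_iff_conj rangeE)
  have "dist (z k) x < \<eta> \<and> J (z k) < J x + c * \<eta>" if "k \<ge> K" for k
    using that
  proof (induction rule: dec_induct)
    case base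
    show ?case using K \<gamma> by auto
  next
    case (step k)
    then have J: "J (z (Suc k)) < J x + c * \<eta>"
      using descent[of k] by linarith
    have "dist (z (Suc k)) x \<le> dist (z (Suc k)) (z k) + dist (z k) x"
      by (rule dist_triangle)
    also have "\<dots> < e"
      using \<delta>[of k] step \<eta> by linarith
    finally have "c * dist (z (Suc k)) x < c * \<eta>"
      using e[of "z (Suc k)"] J by linarith
    with J \<open>c > 0\<close> show ?case by simp
  qed
  with \<eta>(4) show "\<exists>K. \<forall>k\<ge>K. dist (z k) x < \<epsilon>"
    by (meson less_le_trans)
qed

theorem theorem4:
  fixes N nx nu :: nat
    and g h :: "nat \<Rightarrow> real^'n \<Rightarrow> real"
    and Ieq Iineq Jineq :: "nat set"
    and lam tau :: "nat \<Rightarrow> real"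
    and \<rho>0 \<rho>1 \<rho>2 rl \<alpha> \<beta>' r0 :: real
    and z0 zbar :: "real^'n"
    and z :: "nat \<Rightarrow> real^'n"
  assumes "N \<ge> 2" and "nx \<ge> 1" and "nu \<ge> 1"
    and "CARD('n) = nx * N + nu * (N - 1)"
    and "finite Ieq" and "finite Iineq" and "finite Jineq"
    and "Ieq \<inter> Iineq = {}" and "0 \<notin> Ieq \<union> Iineq"
    and "card Ieq = nx * N"
    and "\<And>i. i \<in> {0} \<union> Ieq \<union> Iineq \<Longrightarrow> C1 (g i)"
    and "\<And>j. j \<in> Jineq \<Longrightarrow> C1 (h j)"
    and "\<And>j. j \<in> Jineq \<Longrightarrow> convex_on UNIV (h j)"
    and "\<And>i. i \<in> Ieq \<union> Iineq \<Longrightarrow> lam i > 0"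
    and "\<And>j. j \<in> Jineq \<Longrightarrow> tau j > 0"
    and "0 < \<rho>0" and "\<rho>0 < \<rho>1" and "\<rho>1 < \<rho>2" and "\<rho>2 < 1"
    and "rl > 0" and "\<alpha> > 1" and "\<beta>' > 1" and "r0 > 0"
    and sublevel_compact:
      "compact {y. penalty g h Ieq Iineq Jineq lam tau y \<le> penalty g h Ieq Iineq Jineq lam tau z0}"
    and iterates:
      "scvx_iterates (penalty g h Ieq Iineq Jineq lam tau) (lin_penalty g h Ieq Iineq Jineq lam tau)
         \<rho>0 \<rho>1 \<rho>2 rl \<alpha> \<beta>' z0 r0 z"
    and limit_point: "\<exists>s :: nat \<Rightarrow> nat. strict_mono s \<and> (z \<circ> s) \<longlonglongrightarrow> zbar"
    and "ereal (penalty g h Ieq Iineq Jineq lam tau zbar) > -\<infinity>"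
    and "feasible g h Ieq Iineq Jineq zbar"
    and LICQ:
      "independent_family (case_sum (\<lambda>i. gradient (g i) zbar) (\<lambda>j. gradient (h j) zbar))
         ((Ieq \<union> active g Iineq zbar) <+> active h Jineq zbar)"
    and strict_complementarity:
      "\<exists>\<mu> \<sigma> :: nat \<Rightarrow> real.
         (\<forall>i\<in>active g Iineq zbar. \<mu> i > 0) \<and>
         (\<forall>j\<in>active h Jineq zbar. \<sigma> j > 0) \<and>
         gradient (g 0) zbar
           + (\<Sum>i\<in>Ieq \<union> active g Iineq zbar. \<mu> i *\<^sub>R gradient (g i) zbar)
           + (\<Sum>j\<in>active h Jineq zbar. \<sigma> j *\<^sub>R gradient (h j) zbar) = 0 \<and>
         (\<forall>i\<in>Ieq \<union> active g Iineq zbar. lam i > \<bar>\<mu> i\<bar>) \<and>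
         (\<forall>j\<in>active h Jineq zbar. tau j > \<sigma> j)"
    and binding:
      "card (active g Iineq zbar) + card (active h Jineq zbar) \<ge> nu * (N - 1)"
  shows "z \<longlonglongrightarrow> zbar"
proof -
  let ?J = "penalty g h Ieq Iineq Jineq lam tau"
  let ?L = "lin_penalty g h Ieq Iineq Jineq lam tau"
  have step: "\<exists>r r'. scvx_step ?J ?L \<rho>0 \<rho>1 \<rho>2 rl \<alpha> \<beta>' (z k) r (z (Suc k)) r'" for k
    using iterates unfolding scvx_iterates_def by blast
  have descent: "?J (z (Suc k)) \<le> ?J (z k)" for k
    using step[of k] \<open>0 < \<rho>0\<close> by (auto intro: scvx_step_descent(1) lin_penalty_zero)
  have model: "?L (z k) (z (Suc k) - z k) \<le> ?J (z k)" for k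
    using step[of k] \<open>0 < \<rho>0\<close> by (auto intro: scvx_step_descent(2) lin_penalty_zero)
  note smooth = \<open>finite Ieq\<close> \<open>finite Iineq\<close> \<open>finite Jineq\<close> assms(11,12,14,15)
  obtain c where "c > 0" and sharp: "\<And>d. ?L zbar d \<ge> ?J zbar + c * norm d"
  proof -
    have "card Ieq + card (active g Iineq zbar) + card (active h Jineq zbar) \<ge> CARD('n)"
      using assms(4,10) binding by simp
    moreover from strict_complementarity obtain \<mu> \<sigma> :: "nat \<Rightarrow> real" where
      "\<forall>i\<in>active g Iineq zbar. \<mu> i > 0" "\<forall>j\<in>active h Jineq zbar. \<sigma> j > 0"
      "gradient (g 0) zbar
           + (\<Sum>i\<in>Ieq \<union> active g Iineq zbar. \<mu> i *\<^sub>R gradient (g i) zbar)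
           + (\<Sum>j\<in>active h Jineq zbar. \<sigma> j *\<^sub>R gradient (h j) zbar) = 0"
      "\<forall>i\<in>Ieq \<union> active g Iineq zbar. lam i > \<bar>\<mu> i\<bar>"
      "\<forall>j\<in>active h Jineq zbar. tau j > \<sigma> j"
      by blast
    ultimately have "\<exists>c>0. \<forall>d. ?L zbar d \<ge> ?J zbar + c * norm d"
      using \<open>finite Ieq\<close> \<open>finite Iineq\<close> \<open>finite Jineq\<close> \<open>Ieq \<inter> Iineq = {}\<close> assms(14,15)
        \<open>feasible g h Ieq Iineq Jineq zbar\<close> LICQ
      by (intro lin_penalty_sharp_minimum) (assumption | blast)+
    then show ?thesis
      using that by blast
  qed
  have perturbed: "\<forall>\<^sub>F y in nhds zbar. \<forall>d. \<bar>?L y d - ?L zbar d\<bar> \<le> e * (1 + norm d)"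
    if "e > 0" for e
    by (rule lin_penalty_perturbation[OF smooth that])
  show ?thesis
  proof (rule descent_converges_to_sharp_cluster_point[where J = ?J])
    show "?J (z (Suc k)) \<le> ?J (z k)" for k
      by (rule descent)
    show "(?J \<longlongrightarrow> ?J zbar) (nhds zbar)"
    proof (rule tendstoI)
      fix e :: real assume "e > 0"
      show "\<forall>\<^sub>F y in nhds zbar. dist (?J y) (?J zbar) < e"
        using perturbed[of "e / 2"] \<open>e > 0\<close>
        by (auto elim!: eventually_mono dest!: spec[of _ 0] simp: lin_penalty_zero dist_real_def)
    qed
    show half: "c / 2 > 0" using \<open>c > 0\<close> by simp
    have "\<forall>\<^sub>F y in nhds zbar. \<bar>?J y - ?L zbar (y - zbar)\<bar> \<le> c / 2 * norm (y - zbar)"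
      by (rule penalty_first_order_expansion[OF smooth half])
    then show "\<forall>\<^sub>F y in nhds zbar. ?J y \<ge> ?J zbar + c / 2 * dist y zbar"
    proof eventually_elim
      case (elim y)
      then show ?case
        using sharp[of "y - zbar"] unfolding dist_norm by linarith
    qed
    \<comment> \<open>Short steps: near \<open>zbar\<close> the model at \<open>y\<close> exceeds \<open>?J y\<close> at every step of length \<open>e\<close> or more.\<close>
    show "\<forall>\<^sub>F y in nhds zbar. \<forall>k. z k = y \<longrightarrow> dist (z (Suc k)) y < e" if "e > 0" for e
    proof -
      \<comment> \<open>The bound \<open>c / 2\<close> keeps half of the linear growth; \<open>c * e / 8\<close> makes the rest worth \<open>e / 2\<close>.\<close>
      define t where "t = min (c / 2) (c * e / 8)"
      have "t > 0" "t \<le> c / 2" "t \<le> c * e / 8"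
        using \<open>c > 0\<close> that by (auto simp: t_def)
      show ?thesis
        using perturbed[OF \<open>t > 0\<close>]
      proof eventually_elim
        case (elim y)
        show ?case
        proof (intro allI impI)
          fix k assume y: "z k = y"
          let ?d = "z (Suc k) - y"
          have "?J y \<le> ?J zbar + t"
            using elim[rule_format, of 0] by (simp add: lin_penalty_zero)
          moreover have "?L y ?d \<ge> ?J zbar + c * norm ?d - t * (1 + norm ?d)"
            using sharp[of ?d] elim[rule_format, of ?d] by linarith
          moreover have "?L y ?d \<le> ?J y"
            using model[of k] y by simp
          ultimately have "c * norm ?d \<le> 2 * t + t * norm ?d"
            by (simp add: algebra_simps)
          also have "\<dots> \<le> c * e / 4 + c / 2 * norm ?d"
            using \<open>t \<le> c / 2\<close> \<open>t \<le> c * e / 8\<close> by (intro add_mono mult_right_mono) auto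
          finally have "c * norm ?d \<le> c * (e / 2)"
            by simp
          then have "norm ?d \<le> e / 2"
            using \<open>c > 0\<close> by simp
          with that show "dist (z (Suc k)) y < e"
            by (simp add: dist_norm)
        qed
      qed
    qed
    show "zbar \<in> closure (range z)"
      using limit_point unfolding closure_sequential by (metis comp_apply rangeI)
  qed
qed

end
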